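(* Let $A \in \mathbb{R}^{m \times n}$ have full column rank and let $b \in \mathbb{R}^m$. Let $x = (A^t A)^{-1} A^t b$ be the solution and $r = b - Ax$ the residual of the linear least squares problem $\min_u \|b - Au\|_2$, and assume $x \neq 0$ and $r \neq 0$. Let $\sigma_{\min}$ be the smallest singular value of $A$. Let $\mathcal{A}, \mathcal{B}, \mathcal{R} > 0$ be scale factors, and let $\chi_r(b)$ and $\chi_r(A)$ be the condition numbers of the residual with respect to $b$ and with respect to $A$ for the scaled norms $\|\Delta A\|_2/\mathcal{A}$, $\|\Delta b\|_2/\mathcal{B}$, $\|\Delta r\|_2/\mathcal{R}$. Then $$\chi_r(b) = \frac{\mathcal{B}}{\mathcal{R}},$$ $$\frac{1}{\sqrt 2}\,\frac{\mathcal{A}}{\mathcal{R}} \sqrt{\left(\frac{\|r\|_2}{\sigma_{\min}}\right)^2 + \|x\|_2^2} \;\le\; \chi_r(A) \;\le\; \frac{\mathcal{A}}{\mathcal{R}} \sqrt{\left(\frac{\|r\|_2}{\sigma_{\min}}\right)^2 + \|x\|_2^2}.$$ In particular, for the choice $\mathcal{A} = \|A\|_2$, $\mathcal{B} = \|b\|_2$, $\mathcal{R} = \|r\|_2$, these formulas simplify to $$\chi_r(b) = \csc(\theta), \qquad \frac{1}{\sqrt 2}\,\kappa_2 \sqrt{1 + \left(\frac{\cot(\theta)}{v}\right)^2} \;\le\; \chi_r(A) \;\le\; \kappa_2 \sqrt{1 + \left(\frac{\cot(\theta)}{v}\right)^2},$$ where $\kappa_2 = \|A\|_2/\sigma_{\min}$,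 $\theta$ is the angle between $b$ and the column space of $A$ (so $\cot(\theta) = \|Ax\|_2/\|r\|_2$), and $v = \|Ax\|_2/(\|x\|_2\,\sigma_{\min})$.
   Context: For vectors $\|\cdot\|_2$ is the Euclidean norm; for matrices $\|\cdot\|_2$ is the spectral norm (largest singular value). The residual is regarded as a function $r(A,b) = [I - A(A^tA)^{-1}A^t]\,b$ on pairs with $A \in \mathbb{R}^{m\times n}$ of full column rank and $b \in \mathbb{R}^m$. The condition numbers are the induced operator norms of its partial derivatives (Jacobian matrices) at the given $(A,b)$. Let $J_r(b): \mathbb{R}^m \to \mathbb{R}^m$ be the derivative of $r$ with respect to $b$ with $A$ held fixed, and $J_r(A): \mathbb{R}^{m \times n} \to \mathbb{R}^m$ the derivative of $r$ with respect to (the entries of) $A$ with $b$ held fixed. Then $$\chi_r(b) = \max_{\Delta b \ne 0} \frac{\|J_r(b)\,\Delta b\|_2/\mathcal{R}}{\|\Delta b\|_2/\mathcal{B}}, \qquad \chi_r(A) = \max_{\Delta A \neq 0} \frac{\|J_r(A)[\Delta A]\|_2/\mathcal{R}}{\|\Delta A\|_2/\mathcal{A}},$$ where $\Delta b \in \mathbb{R}^m$, $\Delta A \in \mathbb{R}^{m \times n}$. The scale factors are constants (not differentiated); when chosen in terms of $A$, $b$, $r$ they are evaluated at the given problem. *)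

theory Defs
  imports "HOL-Analysis.Analysis"
begin

text \<open>
  Matrices in \<open>\<real>\<^sup>m\<^sup>\<times>\<^sup>n\<close> have type \<^typ>\<open>real^'n^'m\<close>. The type-class \<^const>\<open>norm\<close> is the
  Euclidean norm on vectors, but on matrices it is the Frobenius norm, so the spectral
  norm is defined separately.

  The singular values of \<open>A\<close> are the nonnegative square roots of the eigenvalues of \<open>A\<^sup>tA\<close>.
  The set is finite and nonempty. For \<open>n > m\<close> this convention also counts \<open>0\<close>, which does not
  affect the largest singular value; the smallest one is only used for matrices of full
  column rank, where \<open>n \<le> m\<close>.
\<close>

definition singular_values :: "real^'n^'m \<Rightarrow> real set" where
  "singular_values A =
     {s. 0 \<le> s \<and> (\<exists>v. v \<noteq> 0 \<and> (transpose A ** A) *v v = s^2 *\<^sub>R v)}"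

definition spectral_norm :: "real^'n^'m \<Rightarrow> real" where
  "spectral_norm A = Max (singular_values A)"

definition sigma_min :: "real^'n^'m \<Rightarrow> real" where
  "sigma_min A = Min (singular_values A)"

definition ls_solution :: "real^'n^'m \<Rightarrow> real^'m \<Rightarrow> real^'n" where
  "ls_solution A b = (matrix_inv (transpose A ** A) ** transpose A) *v b"

definition ls_residual :: "real^'n^'m \<Rightarrow> real^'m \<Rightarrow> real^'m" where
  "ls_residual A b =
     (mat 1 - A ** matrix_inv (transpose A ** A) ** transpose A) *v b"

text \<open>
  Full column rank is an open condition, so the partial derivatives can be taken over all
  of the ambient space.
\<close>

definition J_r_b :: "real^'n^'m \<Rightarrow> real^'m \<Rightarrow> real^'m \<Rightarrow> real^'m" where
  "J_r_b A b = frechet_derivative (\<lambda>b'. ls_residual A b') (at b)"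

definition J_r_A :: "real^'n^'m \<Rightarrow> real^'m \<Rightarrow> real^'n^'m \<Rightarrow> real^'m" where
  "J_r_A A b = frechet_derivative (\<lambda>A'. ls_residual A' b) (at A)"

text \<open>
  Condition numbers as genuine (attained) maxima; the scale factors for \<open>A\<close>, \<open>b\<close> and
  the residual are \<open>sA\<close>, \<open>sB\<close> and \<open>sR\<close>.
\<close>

definition chi_r_b :: "real \<Rightarrow> real \<Rightarrow> real^'n^'m \<Rightarrow> real^'m \<Rightarrow> real" where
  "chi_r_b sB sR A b =
     (GREATEST \<rho>. \<exists>\<Delta>b. \<Delta>b \<noteq> 0 \<and>
        \<rho> = (norm (J_r_b A b \<Delta>b) / sR) / (norm \<Delta>b / sB))"

definition chi_r_A :: "real \<Rightarrow> real \<Rightarrow> real^'n^'m \<Rightarrow> real^'m \<Rightarrow> real" where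
  "chi_r_A sA sR A b =
     (GREATEST \<rho>. \<exists>\<Delta>A. \<Delta>A \<noteq> 0 \<and>
        \<rho> = (norm (J_r_A A b \<Delta>A) / sR) / (spectral_norm \<Delta>A / sA))"

definition angle_vec :: "'a::real_inner \<Rightarrow> 'a \<Rightarrow> real" where
  "angle_vec a b = arccos ((a \<bullet> b) / (norm a * norm b))"

text \<open>The angle between a vector and a subspace is the smallest angle with a nonzero element.\<close>

definition angle_subspace :: "'a::real_inner \<Rightarrow> 'a set \<Rightarrow> real" where
  "angle_subspace b S = (INF u \<in> S - {0}. angle_vec b u)"

definition csc :: "real \<Rightarrow> real" where
  "csc \<theta> = 1 / sin \<theta>"

end

theory Submission
  imports Defs
begin

text \<open>
  Write \<open>P\<close> for the orthogonal projection onto the column space of \<open>A\<close> and \<open>G = (A\<^sup>tA)\<^sup>-\<^sup>1\<close>. The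
  derivative of the residual with respect to \<open>A\<close> is \<open>E \<mapsto> -(I - P) E x - A G E\<^sup>t r\<close>. Its two parts
  are orthogonal and have norms at most \<open>\<parallel>E\<parallel> \<parallel>x\<parallel>\<close> and \<open>\<parallel>E\<parallel> \<parallel>r\<parallel> / \<sigma>\<^sub>m\<^sub>i\<^sub>n\<close>, which gives the upper
  bound. The rank-one perturbations \<open>r x\<^sup>t\<close> and \<open>r w\<^sup>t\<close>, with \<open>w\<close> a right singular vector for
  \<open>\<sigma>\<^sub>m\<^sub>i\<^sub>n\<close>, show that the condition number is at least each of \<open>\<parallel>x\<parallel>\<close> and \<open>\<parallel>r\<parallel> / \<sigma>\<^sub>m\<^sub>i\<^sub>n\<close> (up to
  the scale factors); the larger of the two is at least \<open>1 / sqrt 2\<close> times their Euclidean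
  combination.
\<close>

section \<open>Gram matrix and singular values\<close>

lemma inner_transpose_mult:
  fixes A :: "real^'n^'m"
  shows "(transpose A *v y) \<bullet> x = y \<bullet> (A *v x)"
  by (simp add: dot_lmul_matrix)

lemma inner_gram:
  fixes A :: "real^'n^'m"
  shows "((transpose A ** A) *v x) \<bullet> y = (A *v x) \<bullet> (A *v y)"
  by (simp add: dot_lmul_matrix flip: matrix_vector_mul_assoc)

text \<open>At \<open>v\<close> the form \<open>x \<bullet> T x\<close> attains its minimum 0, so
  its gradient \<open>2 T v\<close> must vanish there. This later turns extremal unit vectors into
  eigenvectors of the Gram matrix.\<close>

lemma psd_kernel:
  fixes T :: "'a::real_inner \<Rightarrow> 'a"
  assumes "linear T" and sym: "\<And>x y. T x \<bullet> y = x \<bullet> T y"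
    and psd: "\<And>x. 0 \<le> x \<bullet> T x" and v: "v \<bullet> T v = 0"
  shows "T v = 0"
proof -
  \<comment> \<open>\<open>u\<close> is the length of a descent step along \<open>- T v\<close>.
    Dividing by \<open>1 + c\<close> instead of \<open>c\<close> keeps it defined for
    \<open>c = 0\<close> and still makes the form negative unless \<open>a = 0\<close>.\<close>
  define a c u where "a = T v \<bullet> T v" and "c = T v \<bullet> T (T v)" and "u = a / (1 + c)"
  have c: "0 \<le> c" using psd[of "T v"] by (simp add: c_def)
  have a: "a = u * (1 + c)" using c by (simp add: u_def)
  have "0 \<le> (v - u *\<^sub>R T v) \<bullet> T (v - u *\<^sub>R T v)" by (rule psd)
  also have "\<dots> = u\<^sup>2 * c - 2 * u * a"
    using v sym[of v "T v"] 
    by (simp add: linear_diff[OF \<open>linear T\<close>] linear_scale[OF \<open>linear T\<close>] a_def c_def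
        power2_eq_square algebra_simps)
  also have "\<dots> = - (u\<^sup>2 * (2 + c))"
    unfolding a by (simp add: algebra_simps power2_eq_square)
  finally have "u\<^sup>2 * (2 + c) \<le> 0" by simp
  with c have "a = 0" by (simp add: mult_le_0_iff a)
  then show ?thesis by (simp add: a_def)
qed

lemma singular_vector_norm:
  fixes A :: "real^'n^'m"
  assumes "0 \<le> s" "(transpose A ** A) *v w = s\<^sup>2 *\<^sub>R w"
  shows "norm (A *v w) = s * norm w"
proof -
  have "(norm (A *v w))\<^sup>2 = (s * norm w)\<^sup>2"
    using inner_gram[of A w w] assms
    by (simp add: power2_norm_eq_inner power_mult_distrib)
  then show ?thesis using assms(1) by (simp add: power2_eq_iff_nonneg)
qed

text \<open>Eigenvectors of the symmetric Gram matrix for distinct eigenvalues are orthogonal, hence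
  independent; choosing one per singular value bounds their number by the dimension. Finiteness
  gives \<open>Max\<close> and \<open>Min\<close> in the definitions their meaning.\<close>

lemma finite_singular_values:
  fixes A :: "real^'n^'m"
  shows "finite (singular_values A)"
proof -
  obtain f where f: "\<And>s. s \<in> singular_values A \<Longrightarrow>
      f s \<noteq> 0 \<and> (transpose A ** A) *v f s = s\<^sup>2 *\<^sub>R f s"
    using bchoice[of "singular_values A" "\<lambda>s w. w \<noteq> 0 \<and> (transpose A ** A) *v w = s\<^sup>2 *\<^sub>R w"]
    by (auto simp: singular_values_def)
  have orth: "f s \<bullet> f t = 0" if "s \<in> singular_values A" "t \<in> singular_values A" "s \<noteq> t" for s t
  proof -
    have "s\<^sup>2 * (f s \<bullet> f t) = t\<^sup>2 * (f s \<bullet> f t)"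
      using inner_gram[of A "f s" "f t"] inner_gram[of A "f t" "f s"] f[OF that(1)] f[OF that(2)]
      by (simp add: inner_commute)
    moreover have "s\<^sup>2 \<noteq> t\<^sup>2"
      using that by (auto simp: singular_values_def power2_eq_iff_nonneg)
    ultimately show ?thesis by simp
  qed
  have inj: "inj_on f (singular_values A)"
    by (rule inj_onI) (metis orth f inner_eq_zero_iff)
  have "independent (f ` singular_values A)"
    by (rule pairwise_orthogonal_independent)
      (use orth f in \<open>auto simp: pairwise_def orthogonal_def\<close>)
  then have "finite (f ` singular_values A)"
    by (rule independent_imp_finite)
  then show ?thesis using inj by (rule finite_imageD)
qed

section \<open>Extreme singular values as extreme stretch factors\<close>

lemma linear_norm_bound_from_unit:
  fixes f :: "'a::real_normed_vector \<Rightarrow> 'b::real_normed_vector"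
  assumes "linear f"
  shows "(\<And>x. norm x = 1 \<Longrightarrow> norm (f x) \<le> c) \<Longrightarrow> norm (f y) \<le> c * norm y"
    and "(\<And>x. norm x = 1 \<Longrightarrow> c \<le> norm (f x)) \<Longrightarrow> c * norm y \<le> norm (f y)"
proof -
  have *: "norm (f (y /\<^sub>R norm y)) = norm (f y) / norm y"
    by (simp add: linear_scale[OF assms] divide_inverse mult.commute)
  have unit: "norm (y /\<^sub>R norm y) = 1" if "y \<noteq> 0"
    using that by simp
  show "norm (f y) \<le> c * norm y" if "\<And>x. norm x = 1 \<Longrightarrow> norm (f x) \<le> c"
    using that[OF unit] unfolding *
    by (cases "y = 0") (auto simp: linear_0[OF assms] field_simps)
  show "c * norm y \<le> norm (f y)" if "\<And>x. norm x = 1 \<Longrightarrow> c \<le> norm (f x)"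
    using that[OF unit] unfolding *
    by (cases "y = 0") (auto simp: linear_0[OF assms] field_simps)
qed

lemma unit_sphere_nonempty: "sphere (0::real^'n) 1 \<noteq> {}"
proof -
  obtain x :: "real^'n" where "norm x = 1"
    using vector_choose_size[of 1] by auto
  then show ?thesis by auto
qed

text \<open>Links the eigenvalue definition to the operator norm. By compactness some unit
  \<open>w\<close> is stretched most, by \<open>s\<close>; every singular value is the stretch
  factor of an eigenvector, hence at most \<open>s\<close>, and \<open>s\<close> is itself a
  singular value.\<close>

lemma spectral_norm_attained:
  fixes A :: "real^'n^'m"
  obtains w where "norm w = 1" "norm (A *v w) = spectral_norm A"
    and "\<And>y. norm (A *v y) \<le> spectral_norm A * norm y"
proof -
  obtain w where w: "norm w = 1" and max: "\<And>y. norm y = 1 \<Longrightarrow> norm (A *v y) \<le> norm (A *v w)"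
    using continuous_attains_sup[of "sphere 0 1" "\<lambda>y. norm (A *v y)", OF compact_sphere unit_sphere_nonempty]
    by (auto simp: continuous_on_norm linear_continuous_on)
  define s where "s = norm (A *v w)"
  have le: "norm (A *v y) \<le> s * norm y" for y
    by (rule linear_norm_bound_from_unit) (use max s_def in auto)
  let ?T = "\<lambda>y. s\<^sup>2 *\<^sub>R y - (transpose A ** A) *v y"
  have q: "y \<bullet> ?T z = s\<^sup>2 * (y \<bullet> z) - (A *v y) \<bullet> (A *v z)" for y z
    using inner_gram[of A z y] by (simp add: inner_diff_right inner_commute)
  \<comment> \<open>The form of \<open>?T\<close> is \<open>s^2 |y|^2 - |A y|^2\<close>, nonnegative
    by maximality of \<open>s\<close> and zero at \<open>w\<close>; so \<open>w\<close> is an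
    eigenvector for \<open>s^2\<close>.\<close>
  have "?T w = 0"
  proof (rule psd_kernel[of ?T w])
    show "linear ?T" by (intro linear_compose_sub linear_compose_scale_right matrix_vector_mul_linear linear_id[unfolded id_def])
    show "?T y \<bullet> z = y \<bullet> ?T z" for y z
      using q[of y z] q[of z y] by (simp add: inner_commute)
    have "(norm (A *v y))\<^sup>2 \<le> (s * norm y)\<^sup>2" for y
      using le by (intro power_mono) auto
    then show "0 \<le> y \<bullet> ?T y" for y
      by (simp add: q power_mult_distrib power2_norm_eq_inner)
    show "w \<bullet> ?T w = 0"
      using w unfolding q by (simp add: s_def power2_norm_eq_inner norm_eq_1)
  qed
  then have mem: "s \<in> singular_values A"
    using w by (auto simp: singular_values_def s_def intro!: exI[of _ w])
  have ub: "t \<le> s" if t: "t \<in> singular_values A" for t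
  proof -
    obtain u where "u \<noteq> 0" "norm (A *v u) = t * norm u"
      using t singular_vector_norm[of t A] by (auto simp: singular_values_def)
    then show ?thesis using le[of u] by simp
  qed
  have "spectral_norm A = s"
    unfolding spectral_norm_def using finite_singular_values ub mem by (rule Max_eqI)
  with w le that[of w] show thesis by (simp add: s_def)
qed

text \<open>The mirror image, with a minimiser and the form of opposite sign. The eigenvector
  equation is kept because the lower bound for \<open>chi_r_A\<close> needs a right singular
  vector.\<close>

lemma sigma_min_attained:
  fixes A :: "real^'n^'m"
  obtains w where "norm w = 1" "norm (A *v w) = sigma_min A"
    and "(transpose A ** A) *v w = (sigma_min A)\<^sup>2 *\<^sub>R w"
    and "\<And>y. sigma_min A * norm y \<le> norm (A *v y)"
proof -
  obtain w where w: "norm w = 1" and min: "\<And>y. norm y = 1 \<Longrightarrow> norm (A *v w) \<le> norm (A *v y)"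
    using continuous_attains_inf[of "sphere 0 1" "\<lambda>y. norm (A *v y)", OF compact_sphere unit_sphere_nonempty]
    by (auto simp: continuous_on_norm linear_continuous_on)
  define s where "s = norm (A *v w)"
  have ge: "s * norm y \<le> norm (A *v y)" for y
    by (rule linear_norm_bound_from_unit) (use min s_def in auto)
  let ?T = "\<lambda>y. (transpose A ** A) *v y - s\<^sup>2 *\<^sub>R y"
  have q: "y \<bullet> ?T z = (A *v y) \<bullet> (A *v z) - s\<^sup>2 * (y \<bullet> z)" for y z
    using inner_gram[of A z y] by (simp add: inner_diff_right inner_commute)
  have T0: "?T w = 0"
  proof (rule psd_kernel[of ?T w])
    show "linear ?T" by (intro linear_compose_sub linear_compose_scale_right matrix_vector_mul_linear linear_id[unfolded id_def])
    show "?T y \<bullet> z = y \<bullet> ?T z" for y z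
      using q[of y z] q[of z y] by (simp add: inner_commute)
    have "(s * norm y)\<^sup>2 \<le> (norm (A *v y))\<^sup>2" for y
      using ge by (intro power_mono) (auto simp: s_def)
    then show "0 \<le> y \<bullet> ?T y" for y
      by (simp add: q power_mult_distrib power2_norm_eq_inner)
    show "w \<bullet> ?T w = 0"
      using w unfolding q by (simp add: s_def power2_norm_eq_inner norm_eq_1)
  qed
  then have mem: "s \<in> singular_values A"
    using w by (auto simp: singular_values_def s_def intro!: exI[of _ w])
  have lb: "s \<le> t" if t: "t \<in> singular_values A" for t
  proof -
    obtain u where "u \<noteq> 0" "norm (A *v u) = t * norm u"
      using t singular_vector_norm[of t A] by (auto simp: singular_values_def)
    then show ?thesis using ge[of u] by simp
  qed
  have "sigma_min A = s"
    unfolding sigma_min_def using finite_singular_values lb mem by (rule Min_eqI)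
  with w ge T0 that[of w] show thesis by (simp add: s_def)
qed

section \<open>Norm properties of the spectral norm\<close>

lemma spectral_norm_bound:
  fixes A :: "real^'n^'m"
  shows "norm (A *v y) \<le> spectral_norm A * norm y"
  by (metis spectral_norm_attained)

lemma sigma_min_bound:
  fixes A :: "real^'n^'m"
  shows "sigma_min A * norm y \<le> norm (A *v y)"
  by (metis sigma_min_attained)

lemma sigma_min_pos:
  fixes A :: "real^'n^'m"
  assumes "inj ((*v) A)"
  shows "0 < sigma_min A"
proof -
  obtain w where w: "norm w = 1" "norm (A *v w) = sigma_min A" by (metis sigma_min_attained)
  then have "A *v w \<noteq> A *v 0" using assms by (metis injD norm_zero zero_neq_one)
  with w show ?thesis by (metis matrix_vector_mult_0_right zero_less_norm_iff)
qed

lemma spectral_norm_nonneg: "0 \<le> spectral_norm A"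
  by (metis spectral_norm_attained norm_ge_zero)

lemma spectral_norm_least:
  fixes A :: "real^'n^'m"
  assumes "\<And>y. norm (A *v y) \<le> c * norm y"
  shows "spectral_norm A \<le> c"
  by (metis assms spectral_norm_attained mult.right_neutral)

lemma spectral_norm_pos:
  fixes A :: "real^'n^'m"
  assumes "A \<noteq> 0"
  shows "0 < spectral_norm A"
proof -
  have "spectral_norm A \<noteq> 0"
  proof
    assume "spectral_norm A = 0"
    then have "A *v y = 0" for y using spectral_norm_bound[of A y] by simp
    then have "A = 0" by (simp add: matrix_eq)
    with assms show False by simp
  qed
  with spectral_norm_nonneg[of A] show ?thesis by simp
qed

lemma spectral_norm_triangle:
  fixes A B :: "real^'n^'m"
  shows "spectral_norm (A + B) \<le> spectral_norm A + spectral_norm B"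
proof (rule spectral_norm_least)
  fix y
  have "norm ((A + B) *v y) \<le> norm (A *v y) + norm (B *v y)"
    by (simp add: matrix_vector_mult_add_rdistrib norm_triangle_ineq)
  also have "\<dots> \<le> (spectral_norm A + spectral_norm B) * norm y"
    using spectral_norm_bound[of A y] spectral_norm_bound[of B y] by (simp add: algebra_simps)
  finally show "norm ((A + B) *v y) \<le> (spectral_norm A + spectral_norm B) * norm y" .
qed

text \<open>Cauchy-Schwarz row by row. Here \<open>norm A\<close> is the Frobenius norm, in which
  the remainder of the derivative must be measured.\<close>

lemma norm_matrix_vector_mult_le:
  fixes A :: "real^'n^'m"
  shows "norm (A *v y) \<le> norm A * norm y"
proof -
  have "(norm (A *v y))\<^sup>2 = (\<Sum>i\<in>UNIV. ((A $ i) \<bullet> y)\<^sup>2)"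
    by (simp add: norm_vec_def L2_set_def sum_nonneg matrix_vector_mul_component)
  also have "\<dots> \<le> (\<Sum>i\<in>UNIV. (norm (A $ i))\<^sup>2 * (norm y)\<^sup>2)"
    by (rule sum_mono) (metis Cauchy_Schwarz_ineq2 abs_le_square_iff abs_mult abs_norm_cancel power_mult_distrib)
  also have "\<dots> = (norm A * norm y)\<^sup>2"
    by (simp add: norm_vec_def[of A] L2_set_def sum_nonneg power_mult_distrib sum_distrib_right)
  finally show ?thesis by (rule power2_le_imp_le) simp
qed

lemma spectral_norm_le_norm: "spectral_norm A \<le> norm A"
  by (rule spectral_norm_least) (rule norm_matrix_vector_mult_le)

lemma spectral_norm_scaleR:
  fixes A :: "real^'n^'m"
  assumes "0 < c"
  shows "spectral_norm (c *\<^sub>R A) = c * spectral_norm A"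
proof -
  have le: "spectral_norm (d *\<^sub>R B) \<le> d * spectral_norm B" if "0 < d" for d and B :: "real^'n^'m"
    by (rule spectral_norm_least)
      (use that spectral_norm_bound[of B] in \<open>simp add: scaleR_matrix_vector_assoc[symmetric] mult.assoc\<close>)
  \<comment> \<open>The reverse inequality is \<open>le\<close> for the factor
    \<open>inverse c\<close> and the scaled matrix.\<close>
  show ?thesis
    using le[OF assms, of A] le[of "inverse c" "c *\<^sub>R A"] assms by (simp add: field_simps)
qed

text \<open>The triangle inequality and domination by the Frobenius norm make it 1-Lipschitz. Needed
  for the compactness argument behind the maximum in \<open>chi_r_A\<close>.\<close>

lemma continuous_on_spectral_norm: "continuous_on S (spectral_norm :: real^'n^'m \<Rightarrow> real)"
proof (rule lipschitz_on_continuous_on)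
  have "spectral_norm A - spectral_norm B \<le> norm (A - B)" for A B :: "real^'n^'m"
    using spectral_norm_triangle[of "A - B" B] spectral_norm_le_norm[of "A - B"] by simp
  then have "\<bar>spectral_norm A - spectral_norm B\<bar> \<le> norm (A - B)" for A B :: "real^'n^'m"
    by (smt (verit) norm_minus_commute)
  then show "1-lipschitz_on S (spectral_norm :: real^'n^'m \<Rightarrow> real)"
    by (simp add: lipschitz_on_def dist_norm)
qed

text \<open>With \<open>z\<close> the image of \<open>y\<close> under the transpose,
  \<open>|z|^2 = y \<bullet> A z \<le> |y| * spectral_norm A * |z|\<close>; one factor
  \<open>|z|\<close> cancels.\<close>

lemma norm_transpose_mult_le:
  fixes A :: "real^'n^'m"
  shows "norm (transpose A *v y) \<le> spectral_norm A * norm y"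
proof -
  let ?z = "transpose A *v y"
  have "norm ?z * norm ?z = y \<bullet> (A *v ?z)"
    by (metis inner_transpose_mult norm_eq_sqrt_inner real_sqrt_mult_self abs_of_nonneg inner_ge_zero)
  also have "\<dots> \<le> norm y * norm (A *v ?z)" by (rule norm_cauchy_schwarz)
  also have "\<dots> \<le> norm y * (spectral_norm A * norm ?z)"
    by (intro mult_left_mono spectral_norm_bound) simp
  finally show ?thesis
    by (cases "norm ?z = 0") (auto simp: mult_ac spectral_norm_nonneg simp del: transpose_matrix_vector)
qed

section \<open>Algebra of the normal equations\<close>

text \<open>For full column rank this is the transpose of the pseudoinverse: it picks the vector of
  the column space that \<open>transpose A\<close> maps to \<open>w\<close>.\<close>

definition gram_lift :: "real^'n^'m \<Rightarrow> real^'n \<Rightarrow> real^'m" where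
  "gram_lift A w = A *v (matrix_inv (transpose A ** A) *v w)"

text \<open>Since \<open>x \<bullet> (A^t A) x = |A x|^2\<close>, injectivity of \<open>A\<close>
  gives the square Gram matrix a trivial kernel, so it is invertible.\<close>

lemma gram_inverse:
  fixes A :: "real^'n^'m"
  assumes "inj ((*v) A)"
  shows "(transpose A ** A) ** matrix_inv (transpose A ** A) = mat 1"
    and "matrix_inv (transpose A ** A) ** (transpose A ** A) = mat 1"
proof -
  have "x = 0" if "(transpose A ** A) *v x = 0" for x
  proof -
    have "(A *v x) \<bullet> (A *v x) = 0" using inner_gram[of A x x] that by simp
    then show ?thesis using assms by (metis inner_eq_zero_iff injD matrix_vector_mult_0_right)
  qed
  then have "invertible (transpose A ** A)"
    by (metis invertible_left_inverse matrix_left_invertible_ker)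
  then have "\<exists>B. (transpose A ** A) ** B = mat 1 \<and> B ** (transpose A ** A) = mat 1"
    by (simp add: invertible_def)
  from someI_ex[OF this] show "(transpose A ** A) ** matrix_inv (transpose A ** A) = mat 1"
    "matrix_inv (transpose A ** A) ** (transpose A ** A) = mat 1"
    by (simp_all add: matrix_inv_def)
qed

lemma transpose_gram_lift:
  assumes "inj ((*v) A)"
  shows "transpose A *v gram_lift A w = w"
  using gram_inverse(1)[OF assms]
  by (simp add: gram_lift_def matrix_vector_mul_assoc matrix_mul_assoc del: transpose_matrix_vector)

lemma ls_solution_mult:
  assumes "inj ((*v) A)"
  shows "ls_solution A (A *v y) = y"
  using gram_inverse(2)[OF assms]
  by (simp add: ls_solution_def matrix_vector_mul_assoc matrix_mul_assoc del: transpose_matrix_vector)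

lemma ls_residual_eq: "ls_residual A b = b - A *v ls_solution A b"
  by (simp add: ls_residual_def ls_solution_def matrix_vector_mult_diff_rdistrib
      matrix_vector_mul_assoc matrix_mul_assoc del: transpose_matrix_vector)

lemma ls_residual_eq_gram_lift: "ls_residual A b = b - gram_lift A (transpose A *v b)"
  by (simp add: ls_residual_def gram_lift_def matrix_vector_mult_diff_rdistrib
      matrix_vector_mul_assoc matrix_mul_assoc del: transpose_matrix_vector)

lemma transpose_ls_residual:
  assumes "inj ((*v) A)"
  shows "transpose A *v ls_residual A b = 0"
  using transpose_gram_lift[OF assms, of "transpose A *v b"]
  by (simp add: ls_residual_eq_gram_lift matrix_vector_mult_diff_distrib del: transpose_matrix_vector)

lemma ls_residual_mult:
  assumes "inj ((*v) A)"
  shows "ls_residual A (A *v y) = 0"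
  by (simp add: ls_residual_eq ls_solution_mult[OF assms])

lemma linear_ls_residual: "linear (ls_residual A)"
  unfolding ls_residual_def by (rule matrix_vector_mul_linear)

lemma linear_gram_lift: "linear (gram_lift A)"
  unfolding gram_lift_def matrix_vector_mul_assoc by (rule matrix_vector_mul_linear)

lemma inner_ls_residual:
  assumes "inj ((*v) A)"
  shows "ls_residual A b \<bullet> (A *v y) = 0"
  using transpose_ls_residual[OF assms, of b] inner_transpose_mult[of A "ls_residual A b" y]
  by (simp del: transpose_matrix_vector)

lemma ls_residual_idem:
  assumes "inj ((*v) A)"
  shows "ls_residual A (ls_residual A b) = ls_residual A b"
  using ls_residual_eq[of A b]
  by (metis assms diff_zero linear_diff linear_ls_residual ls_residual_mult)

lemma norm_ls_pythagoras:
  assumes "inj ((*v) A)"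
  shows "(norm b)\<^sup>2 = (norm (ls_residual A b))\<^sup>2 + (norm (A *v ls_solution A b))\<^sup>2"
proof -
  have "b = ls_residual A b + A *v ls_solution A b" by (simp add: ls_residual_eq)
  then show ?thesis
    using inner_ls_residual[OF assms, of b "ls_solution A b"]
    by (metis norm_add_Pythagorean orthogonal_def)
qed

lemma norm_ls_residual_le:
  assumes "inj ((*v) A)"
  shows "norm (ls_residual A b) \<le> norm b" "norm (A *v ls_solution A b) \<le> norm b"
  using norm_ls_pythagoras[OF assms, of b] by (simp_all add: power2_le_imp_le)

text \<open>Writing the lift as \<open>A y\<close>,
  \<open>|A y|^2 = w \<bullet> y \<le> |w| |y|\<close>, and
  \<open>|y| \<le> |A y| / sigma_min A\<close>; one factor \<open>|A y|\<close> cancels.\<close>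

lemma norm_gram_lift_le:
  assumes "inj ((*v) A)"
  shows "norm (gram_lift A w) \<le> norm w / sigma_min A"
proof -
  define y where "y = matrix_inv (transpose A ** A) *v w"
  have z: "gram_lift A w = A *v y" by (simp add: gram_lift_def y_def)
  have s: "0 < sigma_min A" by (rule sigma_min_pos[OF assms])
  have "norm (A *v y) * norm (A *v y) = w \<bullet> y"
    using transpose_gram_lift[OF assms, of w] inner_transpose_mult[of A "A *v y" y]
    by (metis z norm_eq_sqrt_inner real_sqrt_mult_self abs_of_nonneg inner_ge_zero)
  also have "\<dots> \<le> norm w * norm y" by (rule norm_cauchy_schwarz)
  also have "\<dots> \<le> norm w * (norm (A *v y) / sigma_min A)"
    using sigma_min_bound[of A y] s by (intro mult_left_mono) (auto simp: field_simps)
  finally have "norm (A *v y) * norm (A *v y) \<le> norm w / sigma_min A * norm (A *v y)" by simp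
  then show ?thesis
    unfolding z using s mult_right_le_imp_le[of "norm (A *v y)" "norm (A *v y)" "norm w / sigma_min A"]
    by (cases "A *v y = 0") auto
qed

section \<open>Derivative of the residual with respect to the matrix\<close>

text \<open>Candidate for the derivative, confirmed in \<open>J_r_A_eq\<close>. The outer
  \<open>ls_residual A\<close> acts as the projector \<open>I - P\<close>, the inner one gives the
  residual of \<open>b\<close>.\<close>

definition residual_deriv :: "real^'n^'m \<Rightarrow> real^'m \<Rightarrow> real^'n^'m \<Rightarrow> real^'m" where
  "residual_deriv A b E =
     - ls_residual A (E *v ls_solution A b) - gram_lift A (transpose E *v ls_residual A b)"

lemma transpose_mult_add: "transpose (A + B) *v y = transpose A *v y + transpose B *v (y :: real^'m)"
  by (simp add: vec_eq_iff transpose_def matrix_vector_mult_def algebra_simps sum.distrib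
      del: transpose_matrix_vector)

lemma transpose_mult_scaleR: "transpose (c *\<^sub>R A) *v y = c *\<^sub>R (transpose A *v (y :: real^'m))"
  by (simp add: vec_eq_iff transpose_def matrix_vector_mult_def algebra_simps sum_distrib_left
      del: transpose_matrix_vector)

lemma linear_residual_deriv: "linear (residual_deriv A b)"
proof (rule linearI)
  note lin = linear_add[OF linear_ls_residual] linear_add[OF linear_gram_lift]
    linear_scale[OF linear_ls_residual] linear_scale[OF linear_gram_lift]
  show "residual_deriv A b (E + F) = residual_deriv A b E + residual_deriv A b F" for E F
    by (simp add: residual_deriv_def matrix_vector_mult_add_rdistrib transpose_mult_add lin
        del: transpose_matrix_vector)
  show "residual_deriv A b (c *\<^sub>R E) = c *\<^sub>R residual_deriv A b E" for c E
    by (simp add: residual_deriv_def scaleR_matrix_vector_assoc[symmetric] transpose_mult_scaleR lin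
        scaleR_diff_right del: transpose_matrix_vector)
qed

text \<open>An exact difference formula: replacing the perturbed solution and residual on the right by
  the unperturbed ones gives the derivative.\<close>

lemma ls_residual_diff:
  assumes "inj ((*v) A)" "inj ((*v) (A + E))"
  shows "ls_residual (A + E) b - ls_residual A b =
    - ls_residual A (E *v ls_solution (A + E) b) - gram_lift A (transpose E *v ls_residual (A + E) b)"
proof -
  define r' x' where "r' = ls_residual (A + E) b" and "x' = ls_solution (A + E) b"
  \<comment> \<open>Normal equations of the perturbed problem,
    \<open>(A + E)^t r' = 0\<close>.\<close>
  have "transpose A *v r' = - (transpose E *v r')"
    using transpose_ls_residual[OF assms(2), of b] unfolding r'_def transpose_mult_add
    by (simp add: eq_neg_iff_add_eq_0 del: transpose_matrix_vector)
  \<comment> \<open>Splits \<open>r'\<close> into its components orthogonal to and inside the column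
    space of the unperturbed \<open>A\<close>.\<close>
  then have r': "r' = ls_residual A r' - gram_lift A (transpose E *v r')"
    using ls_residual_eq_gram_lift[of A r']
    by (simp add: linear_neg[OF linear_gram_lift] del: transpose_matrix_vector)
  have "r' = b - A *v x' - E *v x'"
    by (simp add: r'_def x'_def ls_residual_eq matrix_vector_mult_add_rdistrib)
  then have "ls_residual A r' = ls_residual A b - ls_residual A (E *v x')"
    by (simp add: linear_diff[OF linear_ls_residual] ls_residual_mult[OF assms(1)])
  with r' show ?thesis
    by (simp add: r'_def[symmetric] x'_def[symmetric] algebra_simps del: transpose_matrix_vector)
qed

lemma norm_transpose_mult_le_norm:
  fixes E :: "real^'n^'m"
  shows "norm (transpose E *v y) \<le> norm E * norm y"
  using norm_transpose_mult_le[of E y] mult_right_mono[OF spectral_norm_le_norm[of E], of "norm y"]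
  by simp

text \<open>In the exact difference formula the perturbed solution and residual differ from the
  unperturbed ones only to first order in \<open>E\<close>, and each is multiplied by
  \<open>E\<close>; the error is therefore of second order.\<close>

lemma residual_quadratic_bound:
  fixes A E :: "real^'n^'m"
  assumes inj: "inj ((*v) A)" and E: "norm E \<le> sigma_min A / 2"
  shows "norm (ls_residual (A + E) b - ls_residual A b - residual_deriv A b E)
    \<le> 8 * norm b / (sigma_min A)\<^sup>2 * (norm E)\<^sup>2"
proof -
  define s e B r r' x x' where defs: "s = sigma_min A" "e = norm E" "B = norm b"
    "r = ls_residual A b" "r' = ls_residual (A + E) b"
    "x = ls_solution A b" "x' = ls_solution (A + E) b"
  have s: "0 < s" unfolding defs by (rule sigma_min_pos[OF inj])
  have e: "0 \<le> e" "e \<le> s / 2" using E by (auto simp: defs)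
  \<comment> \<open>A perturbation of at most half of \<open>sigma_min A\<close> leaves at least
    half of the stretch, so \<open>A + E\<close> is still injective and \<open>x'\<close> stays
    bounded.\<close>
  have low: "s / 2 * norm y \<le> norm ((A + E) *v y)" for y
  proof -
    have "s * norm y \<le> norm (A *v y)" unfolding defs by (rule sigma_min_bound)
    moreover have "norm (E *v y) \<le> s / 2 * norm y"
      using norm_matrix_vector_mult_le[of E y] mult_right_mono[OF E, of "norm y"] by (simp add: defs)
    moreover have "norm (A *v y) - norm (E *v y) \<le> norm ((A + E) *v y)"
      by (simp add: matrix_vector_mult_add_rdistrib norm_diff_ineq)
    ultimately show ?thesis by (simp add: algebra_simps)
  qed
  have inj': "inj ((*v) (A + E))"
  proof (rule injI)
    fix y z assume "(A + E) *v y = (A + E) *v z"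
    with low[of "y - z"] s show "y = z"
      by (simp add: matrix_vector_mult_diff_distrib mult_le_0_iff)
  qed
  have x': "norm x' \<le> 2 * B / s"
    using low[of x'] norm_ls_residual_le(2)[OF inj', of b] s by (simp add: defs field_simps)
  have r'B: "norm r' \<le> B" unfolding defs by (rule norm_ls_residual_le(1)[OF inj'])
  have Q: "norm (ls_residual A (E *v y)) \<le> e * norm y" for y
    using norm_ls_residual_le(1)[OF inj, of "E *v y"] norm_matrix_vector_mult_le[of E y]
    by (simp add: defs)
  have G: "norm (gram_lift A (transpose E *v y)) \<le> e * norm y / s" for y
    using norm_gram_lift_le[OF inj, of "transpose E *v y"]
      divide_right_mono[OF norm_transpose_mult_le_norm[of E y], of s] s
    by (simp add: defs del: transpose_matrix_vector)
  have diff: "r' - r = - ls_residual A (E *v x') - gram_lift A (transpose E *v r')"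
    unfolding defs by (rule ls_residual_diff[OF inj inj'])
  have "norm (r' - r) \<le> e * norm x' + e * norm r' / s"
    unfolding diff using Q[of x'] G[of r'] norm_triangle_ineq4[of "- ls_residual A (E *v x')" "gram_lift A (transpose E *v r')"]
    by simp
  also have "\<dots> \<le> e * (2 * B / s) + e * B / s"
    using x' r'B e s by (intro add_mono mult_left_mono divide_right_mono) auto
  finally have dr: "norm (r' - r) \<le> 3 * e * B / s" by (simp add: algebra_simps)
  \<comment> \<open>Subtracting the two decompositions of \<open>b\<close> bounds the change of the
    solution by the change of the residual.\<close>
  have "A *v (x' - x) = r - r' - E *v x'"
    by (simp add: defs ls_residual_eq algebra_simps)
  then have "s * norm (x' - x) \<le> norm (r - r' - E *v x')"
    using sigma_min_bound[of A "x' - x"] by (simp add: defs(1))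
  also have "\<dots> \<le> norm (r' - r) + e * norm x'"
    using norm_triangle_ineq4[of "r - r'" "E *v x'"] norm_matrix_vector_mult_le[of E x']
    by (simp add: defs(2) norm_minus_commute)
  also have "\<dots> \<le> 3 * e * B / s + e * (2 * B / s)"
    using x' e dr by (intro add_mono mult_left_mono) auto
  finally have "s * norm (x' - x) \<le> 5 * e * B / s" by (simp add: algebra_simps)
  then have dx: "norm (x' - x) \<le> 5 * e * B / s\<^sup>2" using s by (simp add: field_simps power2_eq_square)
  \<comment> \<open>Difference formula and derivative are the same linear expression in the pairs
    \<open>(x', r')\<close> and \<open>(x, r)\<close>, so only the differences remain. The constant
    8 is 5 from \<open>dx\<close> plus 3 from \<open>dr\<close>.\<close>
  have "r' - r - residual_deriv A b E
      = - ls_residual A (E *v (x' - x)) - gram_lift A (transpose E *v (r' - r))"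
    unfolding matrix_vector_mult_diff_distrib linear_diff[OF linear_ls_residual] linear_diff[OF linear_gram_lift]
    unfolding diff by (simp add: residual_deriv_def defs(4,6))
  then have "norm (r' - r - residual_deriv A b E) \<le> e * norm (x' - x) + e * norm (r' - r) / s"
    using Q[of "x' - x"] G[of "r' - r"]
      norm_triangle_ineq4[of "- ls_residual A (E *v (x' - x))" "gram_lift A (transpose E *v (r' - r))"]
    by simp
  also have "\<dots> \<le> e * (5 * e * B / s\<^sup>2) + e * (3 * e * B / s) / s"
    using dx dr e s by (intro add_mono mult_left_mono divide_right_mono) auto
  also have "\<dots> = 8 * B / s\<^sup>2 * e\<^sup>2"
    using s by (simp add: field_simps power2_eq_square)
  finally show ?thesis by (simp add: defs)
qed

lemma has_derivative_quadratic:
  fixes f :: "'a::real_normed_vector \<Rightarrow> 'b::real_normed_vector"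
  assumes "bounded_linear f'" "0 < d"
    and bound: "\<And>h. norm h < d \<Longrightarrow> norm (f (a + h) - f a - f' h) \<le> C * (norm h)\<^sup>2"
  shows "(f has_derivative f') (at a)"
proof (rule has_derivativeI_sandwich[OF \<open>0 < d\<close> assms(1)])
  show "norm (f y - f a - f' (y - a)) / norm (y - a) \<le> C * norm (y - a)"
    if "y \<noteq> a" "dist y a < d" for y
    using bound[of "y - a"] that by (simp add: dist_norm divide_simps power2_eq_square mult.assoc)
  show "((\<lambda>y. C * norm (y - a)) \<longlongrightarrow> 0) (at a)"
    by (auto intro!: tendsto_eq_intros)
qed

lemma J_r_A_eq:
  fixes A :: "real^'n^'m"
  assumes "inj ((*v) A)"
  shows "J_r_A A b = residual_deriv A b"
proof -
  have "((\<lambda>A'. ls_residual A' b) has_derivative residual_deriv A b) (at A)"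
  proof (rule has_derivative_quadratic)
    show "bounded_linear (residual_deriv A b)"
      using linear_residual_deriv linear_conv_bounded_linear by blast
    show "0 < sigma_min A / 2" using sigma_min_pos[OF assms] by simp
    show "norm (ls_residual (A + E) b - ls_residual A b - residual_deriv A b E)
        \<le> 8 * norm b / (sigma_min A)\<^sup>2 * (norm E)\<^sup>2" if "norm E < sigma_min A / 2" for E
      using residual_quadratic_bound[OF assms] that by simp
  qed
  then show ?thesis unfolding J_r_A_def by (metis frechet_derivative_at)
qed

lemma J_r_b_eq: "J_r_b A b = ls_residual A"
proof -
  have "(ls_residual A has_derivative ls_residual A) (at b)"
    using linear_ls_residual by (rule linear_imp_has_derivative)
  then show ?thesis unfolding J_r_b_def by (metis frechet_derivative_at)
qed

lemma norm_residual_deriv: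
  assumes "inj ((*v) A)"
  shows "(norm (residual_deriv A b E))\<^sup>2 = (norm (ls_residual A (E *v ls_solution A b)))\<^sup>2
    + (norm (gram_lift A (transpose E *v ls_residual A b)))\<^sup>2"
proof -
  let ?p = "ls_residual A (E *v ls_solution A b)" and ?q = "gram_lift A (transpose E *v ls_residual A b)"
  have "?p \<bullet> ?q = 0"
    unfolding gram_lift_def by (rule inner_ls_residual[OF assms])
  then have "orthogonal ?p ?q" by (simp add: orthogonal_def)
  then have "(norm (?p + ?q))\<^sup>2 = (norm ?p)\<^sup>2 + (norm ?q)\<^sup>2"
    by (rule norm_add_Pythagorean)
  moreover have "residual_deriv A b E = - (?p + ?q)" by (simp add: residual_deriv_def)
  ultimately show ?thesis by (metis norm_minus_cancel)
qed

lemma norm_residual_deriv_le: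
  assumes inj: "inj ((*v) A)"
  shows "norm (residual_deriv A b E)
    \<le> spectral_norm E * sqrt ((norm (ls_residual A b) / sigma_min A)\<^sup>2 + (norm (ls_solution A b))\<^sup>2)"
proof (rule power2_le_imp_le)
  let ?r = "ls_residual A b" and ?x = "ls_solution A b"
  have s: "0 < sigma_min A" by (rule sigma_min_pos[OF inj])
  have "norm (ls_residual A (E *v ?x)) \<le> spectral_norm E * norm ?x"
    using norm_ls_residual_le(1)[OF inj] spectral_norm_bound order_trans by blast
  moreover have "norm (gram_lift A (transpose E *v ?r)) \<le> spectral_norm E * (norm ?r / sigma_min A)"
    using norm_gram_lift_le[OF inj, of "transpose E *v ?r"]
      divide_right_mono[OF norm_transpose_mult_le[of E ?r], of "sigma_min A"] s
    by (simp del: transpose_matrix_vector)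
  ultimately have "(norm (residual_deriv A b E))\<^sup>2
      \<le> (spectral_norm E * norm ?x)\<^sup>2 + (spectral_norm E * (norm ?r / sigma_min A))\<^sup>2"
    unfolding norm_residual_deriv[OF inj] by (intro add_mono power_mono) auto
  also have "\<dots> = (spectral_norm E * sqrt ((norm ?r / sigma_min A)\<^sup>2 + (norm ?x)\<^sup>2))\<^sup>2"
    by (simp add: power_mult_distrib power_divide algebra_simps)
  finally show "(norm (residual_deriv A b E))\<^sup>2
      \<le> (spectral_norm E * sqrt ((norm ?r / sigma_min A)\<^sup>2 + (norm ?x)\<^sup>2))\<^sup>2" .
qed (simp add: spectral_norm_nonneg)

section \<open>Rank-one perturbations\<close>

definition outer :: "real^'m \<Rightarrow> real^'n \<Rightarrow> real^'n^'m" where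
  "outer u w = (\<chi> i j. u $ i * w $ j)"

lemma outer_mult: "outer u w *v y = (w \<bullet> y) *\<^sub>R u"
  by (simp add: outer_def vec_eq_iff matrix_vector_mult_def inner_vec_def sum_distrib_left sum_distrib_right mult_ac)

lemma transpose_outer_mult: "transpose (outer u w) *v y = (u \<bullet> y) *\<^sub>R w"
  by (simp add: outer_def transpose_def vec_eq_iff matrix_vector_mult_def inner_vec_def
      sum_distrib_left sum_distrib_right mult_ac del: transpose_matrix_vector)

lemma spectral_norm_outer_le: "spectral_norm (outer u w) \<le> norm u * norm w"
proof (rule spectral_norm_least)
  show "norm (outer u w *v y) \<le> norm u * norm w * norm y" for y
    using mult_left_mono[OF Cauchy_Schwarz_ineq2[of w y] norm_ge_zero[of u]]
    by (simp add: outer_mult mult_ac)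
qed

lemma outer_nonzero:
  assumes "u \<noteq> 0" "w \<noteq> 0"
  shows "outer u w \<noteq> 0"
  using outer_mult[of u w w] assms by auto

text \<open>Applied to a right singular vector for \<open>sigma_min A\<close>, this shows that the
  bound in \<open>norm_gram_lift_le\<close> is sharp.\<close>

lemma gram_lift_gram:
  assumes "inj ((*v) A)"
  shows "gram_lift A ((transpose A ** A) *v w) = A *v w"
  using gram_inverse(2)[OF assms]
  by (simp add: gram_lift_def matrix_vector_mul_assoc flip: matrix_mul_assoc)

text \<open>The perturbations \<open>r w\<^sup>t\<close> lie in the direction where \<open>I - P\<close> acts on \<open>E x\<close> as the identity and
  \<open>E\<^sup>t r\<close> is a multiple of \<open>w\<close>, so each of the two orthogonal parts can be maximised separately.\<close>

lemma norm_residual_deriv_outer: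
  assumes inj: "inj ((*v) A)" and r: "r = ls_residual A b"
  shows "(norm (residual_deriv A b (outer r w)))\<^sup>2
    = (norm r)\<^sup>2 * ((w \<bullet> ls_solution A b)\<^sup>2 + (norm r * norm (gram_lift A w))\<^sup>2)"
  unfolding norm_residual_deriv[OF inj] outer_mult transpose_outer_mult r[symmetric]
  using ls_residual_idem[OF inj, of b]
  by (simp add: linear_scale[OF linear_ls_residual] linear_scale[OF linear_gram_lift] r
      power_mult_distrib algebra_simps flip: power2_norm_eq_inner power_mult)

lemma residual_deriv_ratio_outer:
  fixes A :: "real^'n^'m"
  assumes inj: "inj ((*v) A)" and r: "r = ls_residual A b" "r \<noteq> 0" and w: "w \<noteq> 0"
  shows "\<bar>w \<bullet> ls_solution A b\<bar> / norm w
      \<le> norm (residual_deriv A b (outer r w)) / spectral_norm (outer r w)"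
    and "norm r * norm (gram_lift A w) / norm w
      \<le> norm (residual_deriv A b (outer r w)) / spectral_norm (outer r w)"
proof -
  let ?d = "norm (residual_deriv A b (outer r w))" and ?s = "spectral_norm (outer r w)"
  have s: "0 < ?s" "?s \<le> norm r * norm w"
    using spectral_norm_pos outer_nonzero[OF r(2) w] spectral_norm_outer_le by blast+
  \<comment> \<open>\<open>c\<close> stands for either of the two summands: dropping the other one
    leaves \<open>|r| c\<close> in the numerator, and \<open>|r|\<close> cancels against the bound
    \<open>|r| |w|\<close> on the spectral norm.\<close>
  have gen: "c / norm w \<le> ?d / ?s"
    if c: "0 \<le> c" "c\<^sup>2 \<le> (w \<bullet> ls_solution A b)\<^sup>2 + (norm r * norm (gram_lift A w))\<^sup>2" for c
  proof -
    have "(norm r * c)\<^sup>2 \<le> ?d\<^sup>2"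
      unfolding norm_residual_deriv_outer[OF inj r(1)] power_mult_distrib[of "norm r" c]
      using c(2) by (rule mult_left_mono) simp
    then have d: "norm r * c \<le> ?d" by (rule power2_le_imp_le) simp
    have "c / norm w = norm r * c / (norm r * norm w)" using r(2) by simp
    also have "\<dots> \<le> ?d / ?s" using c d s by (intro frac_le) auto
    finally show ?thesis .
  qed
  show "\<bar>w \<bullet> ls_solution A b\<bar> / norm w \<le> ?d / ?s"
    by (rule gen) simp_all
  show "norm r * norm (gram_lift A w) / norm w \<le> ?d / ?s"
    by (rule gen) simp_all
qed

section \<open>Condition numbers as attained maxima\<close>

text \<open>The ratio is invariant under positive scaling, so its maximum over the compact Frobenius
  unit sphere, where it is continuous, is global. \<open>GREATEST\<close> is informative only once a
  maximum exists.\<close>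

lemma linear_spectral_ratio_attained:
  fixes J :: "real^'n^'m \<Rightarrow> real^'k"
  assumes lin: "linear J"
  obtains E where "E \<noteq> 0"
    and "\<And>F. F \<noteq> 0 \<Longrightarrow> norm (J F) / spectral_norm F \<le> norm (J E) / spectral_norm E"
proof -
  let ?\<rho> = "\<lambda>F. norm (J F) / spectral_norm F" and ?S = "sphere (0::real^'n^'m) 1"
  have nz: "spectral_norm F \<noteq> 0" if "F \<in> ?S" for F
    using that spectral_norm_pos[of F] by (cases "F = 0") auto
  have "continuous_on ?S ?\<rho>"
    using lin nz by (intro continuous_on_divide continuous_on_norm continuous_on_spectral_norm
        linear_continuous_on) (auto simp: linear_conv_bounded_linear)
  moreover have "?S \<noteq> {}"
    using vector_choose_size[of 1, where 'a = "real^'n^'m"] by auto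
  ultimately obtain E where E: "norm E = 1" "\<And>F. norm F = 1 \<Longrightarrow> ?\<rho> F \<le> ?\<rho> E"
    using continuous_attains_sup[of ?S ?\<rho>, OF compact_sphere] by auto
  have "?\<rho> F \<le> ?\<rho> E" if "F \<noteq> 0" for F
  proof -
    have "?\<rho> (F /\<^sub>R norm F) = ?\<rho> F"
      using that by (simp add: linear_scale[OF lin] spectral_norm_scaleR)
    then show ?thesis using E(2)[of "F /\<^sub>R norm F"] that by simp
  qed
  moreover have "E \<noteq> 0" using E(1) by auto
  ultimately show thesis using that by blast
qed

lemma chi_r_A_attained:
  fixes A :: "real^'n^'m"
  assumes inj: "inj ((*v) A)" and pos: "0 < sA" "0 < sR"
  obtains E where "E \<noteq> 0"
    and "chi_r_A sA sR A b = sA / sR * (norm (residual_deriv A b E) / spectral_norm E)"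
    and "\<And>F. F \<noteq> 0 \<Longrightarrow> sA / sR * (norm (residual_deriv A b F) / spectral_norm F) \<le> chi_r_A sA sR A b"
proof -
  let ?\<rho> = "\<lambda>F. norm (residual_deriv A b F) / spectral_norm F"
  obtain E where E: "E \<noteq> 0" and max: "\<And>F. F \<noteq> 0 \<Longrightarrow> ?\<rho> F \<le> ?\<rho> E"
    using linear_spectral_ratio_attained[OF linear_residual_deriv[of A b]] by blast
  have ratio: "norm (J_r_A A b F) / sR / (spectral_norm F / sA) = sA / sR * ?\<rho> F" for F
    by (simp add: J_r_A_eq[OF inj])
  have le: "sA / sR * ?\<rho> F \<le> sA / sR * ?\<rho> E" if "F \<noteq> 0" for F
    using max[OF that] pos by (intro mult_left_mono) auto
  have "chi_r_A sA sR A b = sA / sR * ?\<rho> E"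
    unfolding chi_r_A_def ratio by (rule Greatest_equality) (use E le in blast)+
  with E le that show thesis by metis
qed

lemma chi_r_A_upper:
  fixes A :: "real^'n^'m"
  assumes inj: "inj ((*v) A)" and pos: "0 < sA" "0 < sR"
  shows "chi_r_A sA sR A b
    \<le> sA / sR * sqrt ((norm (ls_residual A b) / sigma_min A)\<^sup>2 + (norm (ls_solution A b))\<^sup>2)"
proof -
  obtain E where "E \<noteq> 0"
    and E: "chi_r_A sA sR A b = sA / sR * (norm (residual_deriv A b E) / spectral_norm E)"
    using chi_r_A_attained[OF assms] by metis
  then show ?thesis
    unfolding E using norm_residual_deriv_le[OF inj, of b E] spectral_norm_pos[of E] pos
    by (intro mult_left_mono) (auto simp: field_simps)
qed

text \<open>Origin of the factor \<open>1 / sqrt 2\<close>: two squares below \<open>c^2\<close> add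
  up to at most \<open>2 * c^2\<close>.\<close>

lemma sqrt_sum_squares_le_max:
  fixes a b :: real
  assumes "0 \<le> a" "0 \<le> b" "a \<le> c" "b \<le> c"
  shows "1 / sqrt 2 * sqrt (a\<^sup>2 + b\<^sup>2) \<le> c"
proof -
  have "a\<^sup>2 \<le> c\<^sup>2" "b\<^sup>2 \<le> c\<^sup>2" using assms by (auto intro: power_mono)
  then have "sqrt (a\<^sup>2 + b\<^sup>2) \<le> sqrt (2 * c\<^sup>2)" by simp
  also have "\<dots> = sqrt 2 * c" using assms by (simp add: real_sqrt_mult)
  finally show ?thesis by (simp add: field_simps)
qed

lemma chi_r_A_lower:
  fixes A :: "real^'n^'m"
  assumes inj: "inj ((*v) A)" and pos: "0 < sA" "0 < sR"
    and x: "ls_solution A b \<noteq> 0" and r: "ls_residual A b \<noteq> 0"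
  shows "1 / sqrt 2 * (sA / sR)
      * sqrt ((norm (ls_residual A b) / sigma_min A)\<^sup>2 + (norm (ls_solution A b))\<^sup>2)
    \<le> chi_r_A sA sR A b"
proof -
  let ?r = "ls_residual A b" and ?x = "ls_solution A b" and ?\<chi> = "chi_r_A sA sR A b"
  have s: "0 < sigma_min A" by (rule sigma_min_pos[OF inj])
  have c: "0 < sA / sR" using pos by simp
  have le: "sA / sR * (norm (residual_deriv A b F) / spectral_norm F) \<le> ?\<chi>" if "F \<noteq> 0" for F
    using chi_r_A_attained[OF inj pos] that by metis
  have low: "t \<le> ?\<chi> / (sA / sR)"
    if "t \<le> norm (residual_deriv A b (outer ?r w)) / spectral_norm (outer ?r w)" "w \<noteq> 0" for t w
  proof -
    have "sA / sR * t \<le> ?\<chi>"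
      using le[OF outer_nonzero[OF r \<open>w \<noteq> 0\<close>]] mult_left_mono[OF that(1), of "sA / sR"] c by simp
    then show ?thesis using c by (simp add: pos_le_divide_eq mult.commute del: times_divide_eq_left times_divide_eq_right divide_divide_eq_right)
  qed
  \<comment> \<open>First witness: the perturbation \<open>outer ?r ?x\<close>, aligned with the
    solution.\<close>
  have "\<bar>?x \<bullet> ?x\<bar> / norm ?x = norm ?x"
    using x by (simp add: power2_eq_square flip: power2_norm_eq_inner)
  then have 1: "norm ?x \<le> ?\<chi> / (sA / sR)"
    using low[OF residual_deriv_ratio_outer(1)[OF inj refl r x] x] by simp
  \<comment> \<open>Second witness: \<open>outer ?r w\<close> with \<open>w\<close> a right singular
    vector for \<open>sigma_min A\<close>, on which \<open>gram_lift A\<close> attains its norm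
    \<open>1 / sigma_min A\<close>.\<close>
  obtain w where w: "norm w = 1" "norm (A *v w) = sigma_min A"
    "(transpose A ** A) *v w = (sigma_min A)\<^sup>2 *\<^sub>R w"
    by (metis sigma_min_attained)
  then have w0: "w \<noteq> 0" by auto
  have "(sigma_min A)\<^sup>2 * norm (gram_lift A w) = sigma_min A"
    using arg_cong[OF gram_lift_gram[OF inj, of w], of norm] w
    by (simp add: linear_scale[OF linear_gram_lift])
  then have "norm (gram_lift A w) = 1 / sigma_min A"
    using s by (simp add: field_simps power2_eq_square)
  then have 2: "norm ?r / sigma_min A \<le> ?\<chi> / (sA / sR)"
    using low[OF residual_deriv_ratio_outer(2)[OF inj refl r w0] w0] w(1) by simp
  have "1 / sqrt 2 * sqrt ((norm ?r / sigma_min A)\<^sup>2 + (norm ?x)\<^sup>2) \<le> ?\<chi> / (sA / sR)"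
    using s 1 2 by (intro sqrt_sum_squares_le_max) auto
  from mult_right_mono[OF this, of "sA / sR"]
  have "1 / sqrt 2 * sqrt ((norm ?r / sigma_min A)\<^sup>2 + (norm ?x)\<^sup>2) * (sA / sR) \<le> ?\<chi>"
    using pos by simp
  then show ?thesis by (simp only: mult_ac)
qed

text \<open>The derivative in \<open>b\<close> is the orthogonal projector \<open>I - P\<close>: it
  never increases norms, and it fixes the nonzero residual, which attains the maximum.\<close>

lemma chi_r_b_eq:
  fixes A :: "real^'n^'m"
  assumes inj: "inj ((*v) A)" and pos: "0 < sB" "0 < sR" and r: "ls_residual A b \<noteq> 0"
  shows "chi_r_b sB sR A b = sB / sR"
  unfolding chi_r_b_def J_r_b_eq
proof (rule Greatest_equality)
  let ?r = "ls_residual A b"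
  show "\<exists>\<Delta>b. \<Delta>b \<noteq> 0 \<and> sB / sR = norm (ls_residual A \<Delta>b) / sR / (norm \<Delta>b / sB)"
    using r ls_residual_idem[OF inj, of b] by (intro exI[of _ ?r]) simp
  fix \<rho> assume "\<exists>\<Delta>b. \<Delta>b \<noteq> 0 \<and> \<rho> = norm (ls_residual A \<Delta>b) / sR / (norm \<Delta>b / sB)"
  then obtain d where d: "d \<noteq> 0" "\<rho> = sB / sR * (norm (ls_residual A d) / norm d)" by auto
  have "norm (ls_residual A d) / norm d \<le> 1"
    using norm_ls_residual_le(1)[OF inj, of d] d(1) by simp
  then have "sB / sR * (norm (ls_residual A d) / norm d) \<le> sB / sR * 1"
    using pos by (intro mult_left_mono) auto
  then show "\<rho> \<le> sB / sR" by (simp add: d(2))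
qed

section \<open>Angle between the right-hand side and the column space\<close>

lemma span_columns_eq_range:
  fixes A :: "real^'n^'m"
  shows "span (columns A) = range ((*v) A)"
proof
  have "column i A = A *v axis i 1" for i by (simp add: matrix_vector_mult_basis)
  then have "columns A \<subseteq> range ((*v) A)" by (auto simp: columns_def)
  then show "span (columns A) \<subseteq> range ((*v) A)"
    by (rule span_minimal) (simp add: linear_subspace_image)
qed (use matrix_vector_mult_in_columnspace in blast)

text \<open>Every \<open>u\<close> in the column space satisfies
  \<open>b \<bullet> u = p \<bullet> u\<close>, so by Cauchy-Schwarz the cosine is largest at
  \<open>u = p\<close>; \<open>arccos\<close> is decreasing, hence the infimum is attained
  there.\<close>

lemma angle_subspace_range:
  fixes A :: "real^'n^'m"
  assumes inj: "inj ((*v) A)" and p: "p = A *v ls_solution A b" "p \<noteq> 0"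
  shows "angle_subspace b (span (columns A)) = arccos (norm p / norm b)"
  unfolding angle_subspace_def span_columns_eq_range angle_vec_def
proof (rule cInf_eq_minimum)
  have dot: "b \<bullet> (A *v y) = p \<bullet> (A *v y)" for y
    using inner_ls_residual[OF inj, of b y] by (simp add: ls_residual_eq p inner_diff_left)
  have pb: "norm p \<le> norm b" unfolding p by (rule norm_ls_residual_le(2)[OF inj])
  then have b: "0 < norm b" using p(2) by (metis less_le_trans zero_less_norm_iff)
  have "b \<bullet> p = (norm p)\<^sup>2" using dot[of "ls_solution A b"] by (simp add: p power2_norm_eq_inner)
  then have "b \<bullet> p / (norm b * norm p) = norm p / norm b"
    using p(2) by (simp add: power2_eq_square)
  then show "arccos (norm p / norm b)
      \<in> (\<lambda>u. arccos (b \<bullet> u / (norm b * norm u))) ` (range ((*v) A) - {0})"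
    using p by (intro image_eqI[of _ _ p]) auto
  fix \<phi> assume "\<phi> \<in> (\<lambda>u. arccos (b \<bullet> u / (norm b * norm u))) ` (range ((*v) A) - {0})"
  then obtain u y where u: "u = A *v y" "u \<noteq> 0" "\<phi> = arccos (b \<bullet> u / (norm b * norm u))" by auto
  have "b \<bullet> u \<le> norm p * norm u" unfolding u(1) dot by (rule norm_cauchy_schwarz)
  then have "b \<bullet> u / (norm b * norm u) \<le> norm p / norm b"
    using b u(2) by (simp add: field_simps)
  moreover have "\<bar>b \<bullet> u / (norm b * norm u)\<bar> \<le> 1"
    using Cauchy_Schwarz_ineq2[of b u] b u(2) by (simp add: abs_mult)
  moreover have "\<bar>norm p / norm b\<bar> \<le> 1" using pb b by simp
  ultimately show "arccos (norm p / norm b) \<le> \<phi>"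
    unfolding u(3) by (simp only: arccos_le_mono)
qed

lemma angle_range_cos_sin:
  fixes A :: "real^'n^'m"
  assumes inj: "inj ((*v) A)" and p: "A *v ls_solution A b \<noteq> 0"
  shows "cos (angle_subspace b (span (columns A))) = norm (A *v ls_solution A b) / norm b"
    and "sin (angle_subspace b (span (columns A))) = norm (ls_residual A b) / norm b"
proof -
  let ?p = "A *v ls_solution A b" and ?r = "ls_residual A b"
  have pb: "norm ?p \<le> norm b" by (rule norm_ls_residual_le(2)[OF inj])
  with p have b: "0 < norm b" by (metis less_le_trans zero_less_norm_iff)
  have c: "\<bar>norm ?p / norm b\<bar> \<le> 1" using pb b by simp
  have "(norm ?r)\<^sup>2 = (norm b)\<^sup>2 - (norm ?p)\<^sup>2"
    using norm_ls_pythagoras[OF inj, of b] by simp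
  \<comment> \<open>The sine comes from the Pythagorean splitting of \<open>b\<close> into fitted
    part and residual.\<close>
  then have "1 - (norm ?p / norm b)\<^sup>2 = (norm ?r / norm b)\<^sup>2"
    using b by (simp add: power_divide diff_divide_distrib)
  then show "cos (angle_subspace b (span (columns A))) = norm ?p / norm b"
    "sin (angle_subspace b (span (columns A))) = norm ?r / norm b"
    using c by (simp_all add: angle_subspace_range[OF inj refl p] cos_arccos_abs sin_arccos_abs)
qed

section \<open>Combination of the bounds and their trigonometric form\<close>

theorem theorem4p1:
  fixes A :: "real^'n^'m" and b r :: "real^'m" and x :: "real^'n"
    and \<kappa> \<theta> v :: real
  assumes full_rank: "rank A = CARD('n)"
    and x_def: "x = ls_solution A b"
    and r_def: "r = b - A *v x"
    and x_nz: "x \<noteq> 0" and r_nz: "r \<noteq> 0"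
    and kappa_def: "\<kappa> = spectral_norm A / sigma_min A"
    and theta_def: "\<theta> = angle_subspace b (span (columns A))"
    and v_def: "v = norm (A *v x) / (norm x * sigma_min A)"
  shows
    "(\<forall>sA sB sR :: real. sA > 0 \<longrightarrow> sB > 0 \<longrightarrow> sR > 0 \<longrightarrow>
        chi_r_b sB sR A b = sB / sR
      \<and> 1 / sqrt 2 * (sA / sR) * sqrt ((norm r / sigma_min A)^2 + (norm x)^2) \<le> chi_r_A sA sR A b
      \<and> chi_r_A sA sR A b \<le> sA / sR * sqrt ((norm r / sigma_min A)^2 + (norm x)^2))
   \<and> cot \<theta> = norm (A *v x) / norm r
   \<and> chi_r_b (norm b) (norm r) A b = csc \<theta>
   \<and> 1 / sqrt 2 * \<kappa> * sqrt (1 + (cot \<theta> / v)^2) \<le> chi_r_A (spectral_norm A) (norm r) A b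
   \<and> chi_r_A (spectral_norm A) (norm r) A b \<le> \<kappa> * sqrt (1 + (cot \<theta> / v)^2)"
proof -
  have inj: "inj ((*v) A)" using full_rank by (simp add: full_rank_injective)
  have r: "r = ls_residual A b" by (simp add: r_def x_def ls_residual_eq)
  have s: "0 < sigma_min A" by (rule sigma_min_pos[OF inj])
  have p: "A *v x \<noteq> 0" using inj x_nz by (metis injD matrix_vector_mult_0_right)
  then have "A \<noteq> 0" by auto
  then have nA: "0 < spectral_norm A" by (rule spectral_norm_pos)
  have nb: "0 < norm b"
    using norm_ls_residual_le(2)[OF inj, of b] p by (metis x_def less_le_trans zero_less_norm_iff)
  have nr: "0 < norm r" using r_nz by simp
  have b: "chi_r_b sB sR A b = sB / sR" if "0 < sB" "0 < sR" for sB sR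
    using chi_r_b_eq[OF inj that] r_nz r by simp
  have lower: "1 / sqrt 2 * (sA / sR) * sqrt ((norm r / sigma_min A)^2 + (norm x)^2) \<le> chi_r_A sA sR A b"
    and upper: "chi_r_A sA sR A b \<le> sA / sR * sqrt ((norm r / sigma_min A)^2 + (norm x)^2)"
    if "0 < sA" "0 < sR" for sA sR
    using chi_r_A_lower[OF inj that] chi_r_A_upper[OF inj that] x_nz r_nz unfolding x_def r by blast+
  have cos: "cos \<theta> = norm (A *v x) / norm b" and sin: "sin \<theta> = norm r / norm b"
    using angle_range_cos_sin[OF inj] p unfolding theta_def x_def r by blast+
  have cot: "cot \<theta> = norm (A *v x) / norm r" using nb by (simp add: cot_def cos sin)
  have csc: "csc \<theta> = norm b / norm r" by (simp add: csc_def sin)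
  \<comment> \<open>The factor \<open>|A x|\<close> cancels between \<open>cot \<theta>\<close> and
    \<open>v\<close>; it is nonzero by injectivity.\<close>
  have cot_v: "cot \<theta> / v = norm x * sigma_min A / norm r" using p by (simp add: cot v_def)
  \<comment> \<open>Pulling \<open>|r| / sigma_min A\<close> out of the root turns the general bound
    with scale factors \<open>spectral_norm A\<close> and \<open>norm r\<close> into the one with
    \<open>\<kappa>\<close>.\<close>
  have "norm r / sigma_min A * sqrt (1 + (norm x * sigma_min A / norm r)\<^sup>2)
      = sqrt ((norm r / sigma_min A)\<^sup>2 + (norm x)\<^sup>2)"
  proof -
    have "(norm r / sigma_min A)\<^sup>2 + (norm x)\<^sup>2
        = (norm r / sigma_min A)\<^sup>2 * (1 + (norm x * sigma_min A / norm r)\<^sup>2)"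
      using nr s by (simp add: field_simps)
    then show ?thesis using nr s by (simp only: real_sqrt_mult real_sqrt_abs) simp
  qed
  from this[symmetric] have \<kappa>: "\<kappa> * sqrt (1 + (cot \<theta> / v)\<^sup>2)
      = spectral_norm A / norm r * sqrt ((norm r / sigma_min A)\<^sup>2 + (norm x)\<^sup>2)"
    using nr by (simp add: kappa_def cot_v)
  have "1 / sqrt 2 * \<kappa> * sqrt (1 + (cot \<theta> / v)\<^sup>2) \<le> chi_r_A (spectral_norm A) (norm r) A b"
    using lower[OF nA nr] by (simp only: mult.assoc \<kappa>)
  moreover have "chi_r_A (spectral_norm A) (norm r) A b \<le> \<kappa> * sqrt (1 + (cot \<theta> / v)\<^sup>2)"
    using upper[OF nA nr] by (simp only: \<kappa>)
  moreover have "chi_r_b (norm b) (norm r) A b = csc \<theta>" using b[OF nb nr] csc by simp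
  ultimately show ?thesis using b lower upper cot by blast
qed

end
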